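(* Let $c(n)$ denote the number of length-$n$ factors of the Thue-Morse word $\mathbf{t}$, counted up to cyclic rotation. Then $\liminf_{n \rightarrow \infty} c(n)/n = 4/3$.
   Context: The Thue-Morse word is the infinite binary word $\mathbf{t} = t_0 t_1 t_2 \cdots = 01101001\cdots$, where $t_m$ is the parity of the number of $1$s in the binary representation of $m$. A length-$n$ factor of $\mathbf{t}$ is a word of the form $t_i t_{i+1} \cdots t_{i+n-1}$ for some $i \geq 0$. Two words $x,y$ are cyclically equivalent (equal up to cyclic rotation) if there are words $u,v$ (possibly empty) with $x = uv$ and $y = vu$. For $n \ge 0$, $c(n)$ is the number of cyclic-equivalence classes of words that contain at least one length-$n$ factor of $\mathbf{t}$; i.e., factors of length $n$ that are the same up to cyclic shift are counted once (so $c(0)=1$, $c(1)=2$, $c(2)=3$, $c(3)=2$, $c(4)=4$). *)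

theory Defs
  imports "HOL-Library.Extended_Real" "HOL-Library.Liminf_Limsup"
begin

definition thue_morse :: "nat \<Rightarrow> nat" where
  "thue_morse m = card {k. bit m k} mod 2"

definition tm_factors :: "nat \<Rightarrow> nat list set" where
  "tm_factors n = range (\<lambda>i. map thue_morse [i..<i + n])"

lemma finite_bits_nat: "finite {k. bit (m :: nat) k}"
proof (rule finite_subset)
  show "{k. bit m k} \<subseteq> {..<m}"
  proof
    fix k assume "k \<in> {k. bit m k}"
    then have "2 ^ k \<le> m"
      by (metis bit_iff_odd div_less even_zero mem_Collect_eq not_le)
    then show "k \<in> {..<m}"
      using less_le_trans [OF less_exp] by simp
  qed
qed simp

lemma finite_tm_factors: "finite (tm_factors n)"
proof (rule finite_subset)
  show "tm_factors n \<subseteq> {xs. set xs \<subseteq> {0, 1} \<and> length xs = n}"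
    by (auto simp: tm_factors_def thue_morse_def)
qed (simp add: finite_lists_length_eq)

definition cyclic_equiv :: "('a list \<times> 'a list) set" where
  "cyclic_equiv = {(x, y). \<exists>u v. x = u @ v \<and> y = v @ u}"

lemma equiv_cyclic_equiv: "equiv UNIV (cyclic_equiv :: ('a list \<times> 'a list) set)"
proof (rule equivI)
  show "sym cyclic_equiv"
    by (auto simp: sym_def cyclic_equiv_def)
  show "refl_on UNIV cyclic_equiv"
    by (auto simp: refl_on_def cyclic_equiv_def intro: exI[of _ "[]"])
  show "trans (cyclic_equiv :: ('a list \<times> 'a list) set)"
  proof (rule transI)
    have rot: "(x, y) \<in> cyclic_equiv \<longleftrightarrow> (\<exists>k. y = rotate k x)" for x y :: "'a list"
    proof
      assume "(x, y) \<in> cyclic_equiv"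
      then show "\<exists>k. y = rotate k x"
        unfolding cyclic_equiv_def by (auto intro: rotate_append [symmetric])
    next
      assume "\<exists>k. y = rotate k x"
      then show "(x, y) \<in> cyclic_equiv"
        unfolding cyclic_equiv_def by (auto simp: rotate_drop_take intro!: append_take_drop_id [symmetric])
    qed
    fix x y z :: "'a list"
    assume "(x, y) \<in> cyclic_equiv" "(y, z) \<in> cyclic_equiv"
    then show "(x, z) \<in> cyclic_equiv"
      unfolding rot using rotate_rotate by metis
  qed
qed simp

text \<open>
  The relation lives on all words, so the elements of this quotient are the full cyclic
  classes that contain at least one factor of length \<open>n\<close>.
\<close>
definition cyclic_complexity :: "nat \<Rightarrow> nat" where
  "cyclic_complexity n = card (tm_factors n // cyclic_equiv)"

end

theory Submission
  imports Defs
begin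

text \<open>
  Let \<open>d n\<close> and \<open>s n\<close> be the numbers of factors of length \<open>n + 1\<close> whose end letters differ,
  respectively agree. Equal neighbouring letters sit at odd positions only, so every long factor
  knows the parity of its position and desubstitutes uniquely. This gives
  \<open>d (2m) = 2 d m\<close>, \<open>d (2m + 1) = s m + s (m + 1)\<close> and symmetrically for \<open>s\<close>, whence
  \<open>d n \<ge> 4n/3\<close> (jointly with \<open>s n \<ge> n\<close> and \<open>d n + s n \<ge> 3n\<close>), with equality at
  \<open>n = 3 \<cdot> 2 ^ k\<close>.

  The same parity argument on cyclic words gives \<open>c (2n) = c n + d n\<close>: a factor of length \<open>2n\<close> is
  conjugate to the image of a factor of length \<open>n\<close> unless it starts at an odd position and has
  equal end letters, and the latter factors are not conjugate to any other factor. For odd \<open>n\<close>,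
  conjugate factors are rotations of each other by at most four letters and \<open>c n \<ge> d n - O(1)\<close>.
  Hence \<open>c n \<ge> 4n/3 - O(1)\<close> for all \<open>n\<close>, while \<open>c (12 \<cdot> 2 ^ k) = 16 \<cdot> 2 ^ k + O(1)\<close>.
\<close>

section \<open>Parity and squares of letters in the Thue-Morse word\<close>

lemma thue_morse_double: "thue_morse (2 * m) = thue_morse m"
proof -
  have "{k. bit (2 * m) k} = Suc ` {k. bit m k}"
    by (auto simp: bit_double_iff image_iff Suc_le_eq gr0_conv_Suc)
  then show ?thesis
    by (simp add: thue_morse_def card_image)
qed

lemma thue_morse_le_1: "thue_morse m \<le> 1"
  by (simp add: thue_morse_def)

lemma thue_morse_double_Suc: "thue_morse (Suc (2 * m)) = 1 - thue_morse m"
proof -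
  have "{k. bit (Suc (2 * m)) k} = insert 0 (Suc ` {k. bit m k})"
  proof (rule set_eqI)
    fix k show "k \<in> {k. bit (Suc (2 * m)) k} \<longleftrightarrow> k \<in> insert 0 (Suc ` {k. bit m k})"
      by (cases k) (auto simp: bit_Suc bit_0)
  qed
  moreover have "card (insert 0 (Suc ` {k. bit m k})) = Suc (card {k. bit m k})"
    by (subst card_insert_disjoint) (auto simp: finite_bits_nat card_image)
  ultimately show ?thesis
    by (simp add: thue_morse_def mod_Suc)
qed

lemma thue_morse_neq_iff: "thue_morse i \<noteq> thue_morse j \<longleftrightarrow> thue_morse i = 1 - thue_morse j"
  using thue_morse_le_1[of i] thue_morse_le_1[of j] by (auto simp: le_Suc_eq)

text \<open>The letters at \<open>2 * m\<close> and \<open>Suc (2 * m)\<close> are complementary.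
  This is how a word reveals the parity of its position.\<close>

lemma odd_if_thue_morse_eq_Suc:
  assumes "thue_morse k = thue_morse (Suc k)"
  shows "odd k"
proof
  assume "even k"
  then obtain m where "k = 2 * m" by blast
  then show False
    using assms thue_morse_le_1[of m] by (auto simp: thue_morse_double thue_morse_double_Suc le_Suc_eq)
qed

lemma thue_morse_cube_free:
  "\<not> (thue_morse k = thue_morse (Suc k) \<and> thue_morse (Suc k) = thue_morse (Suc (Suc k)))"
  using odd_if_thue_morse_eq_Suc[of k] odd_if_thue_morse_eq_Suc[of "Suc k"] by auto

text \<open>The neighbours at \<open>Suc (2 * m)\<close> are \<open>1 - thue_morse m\<close> and
  \<open>thue_morse (Suc m)\<close>; they agree iff the letters at \<open>m\<close> and
  \<open>Suc m\<close> differ. Cube-freeness forces this at \<open>m\<close> or at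
  \<open>Suc m\<close>, and four consecutive positions contain two odd ones.\<close>

lemma thue_morse_square_within_5:
  "\<exists>l<4. thue_morse (i + l) = thue_morse (Suc (i + l))"
proof -
  have *: "thue_morse (Suc (2 * m)) = thue_morse (Suc (Suc (2 * m))) \<or>
      thue_morse (Suc (2 * (Suc m))) = thue_morse (Suc (Suc (2 * (Suc m))))" for m
  proof -
    have eq: "thue_morse (Suc (Suc (2 * q))) = thue_morse (Suc q)" for q
      using thue_morse_double[of "Suc q"] by simp
    show ?thesis
      using thue_morse_cube_free[of m] thue_morse_neq_iff[of "Suc m" m]
        thue_morse_neq_iff[of "Suc (Suc m)" "Suc m"]
      unfolding eq thue_morse_double_Suc by metis
  qed
  show ?thesis
  proof (cases "even i")
    case True
    then obtain m where "i = 2 * m" by blast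
    then show ?thesis using *[of m]
      by (auto intro: exI[of _ 1] exI[of _ 3] simp: numeral_eq_Suc)
  next
    case False
    then obtain m where "i = Suc (2 * m)" by (auto elim: oddE)
    then show ?thesis using *[of m]
      by (auto intro: exI[of _ 0] exI[of _ 2] simp: numeral_eq_Suc)
  qed
qed

section \<open>Factors as windows and their desubstitution\<close>

definition window :: "nat \<Rightarrow> nat \<Rightarrow> nat list" where
  "window i n = map thue_morse [i..<i + n]"

lemma tm_factors_eq: "tm_factors n = range (\<lambda>i. window i n)"
  by (simp add: tm_factors_def window_def)

lemma window_in_tm_factors [simp]: "window i n \<in> tm_factors n"
  by (simp add: tm_factors_eq)

lemma length_window [simp]: "length (window i n) = n"
  by (simp add: window_def)

lemma nth_window [simp]: "l < n \<Longrightarrow> window i n ! l = thue_morse (i + l)"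
  by (simp add: window_def)

lemma window_0 [simp]: "window i 0 = []"
  by (simp add: window_def)

lemma window_Suc: "window i (Suc n) = thue_morse i # window (Suc i) n"
  by (rule nth_equalityI) (auto simp: nth_Cons split: nat.split)

lemma window_Suc_right: "window i (Suc n) = window i n @ [thue_morse (i + n)]"
  by (simp add: window_def)

lemma drop_window: "drop k (window i n) = window (i + k) (n - k)"
  by (rule nth_equalityI) (auto simp: add_ac)

lemma take_window: "k \<le> n \<Longrightarrow> take k (window i n) = window i k"
  by (rule nth_equalityI) auto

lemma window_eq_iff: "window i n = window j n \<longleftrightarrow> (\<forall>l<n. thue_morse (i + l) = thue_morse (j + l))"
  by (auto simp: list_eq_iff_nth_eq)

lemma window_eq_parity:
  assumes "window i n = window j n" "5 \<le> n"
  shows "even i \<longleftrightarrow> even j"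
proof -
  obtain l where l: "l < 4" "thue_morse (i + l) = thue_morse (Suc (i + l))"
    using thue_morse_square_within_5 by blast
  have "thue_morse (i + l) = thue_morse (j + l)" "thue_morse (i + Suc l) = thue_morse (j + Suc l)"
    using assms l(1) unfolding window_eq_iff by (auto elim: allE[of _ l] allE[of _ "Suc l"])
  then have "thue_morse (j + l) = thue_morse (Suc (j + l))" using l by simp
  then have "odd (j + l)" "odd (i + l)" using l odd_if_thue_morse_eq_Suc by blast+
  then show ?thesis by simp
qed

text \<open>The window at \<open>2 * i + e\<close> meets exactly \<open>(n + e + 1) div 2\<close>
  blocks (a, 1 - a), the first being the image of the letter at \<open>i\<close>, and either letter
  of a block determines a.\<close>

lemma window_double_eq_iff:
  assumes "e \<le> 1" "0 < n"
  shows "window (2 * i + e) n = window (2 * j + e) n \<longleftrightarrow>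
    window i ((n + e + 1) div 2) = window j ((n + e + 1) div 2)"
proof -
  have letter: "thue_morse (2 * i + k) = thue_morse (2 * j + k) \<longleftrightarrow>
      thue_morse (i + k div 2) = thue_morse (j + k div 2)" for k
  proof (cases "even k")
    case True
    then obtain m where "k = 2 * m" by blast
    then show ?thesis
      using thue_morse_double[of "i + m"] thue_morse_double[of "j + m"] by simp
  next
    case False
    then obtain m where "k = Suc (2 * m)" by (auto elim: oddE)
    then show ?thesis
      using thue_morse_double_Suc[of "i + m"] thue_morse_double_Suc[of "j + m"]
        thue_morse_le_1[of "i + m"] thue_morse_le_1[of "j + m"] by (auto simp: le_Suc_eq)
  qed
  show ?thesis
    unfolding window_eq_iff
  proof (intro iffI allI impI)
    fix l
    assume *: "\<forall>l<n. thue_morse (2 * i + e + l) = thue_morse (2 * j + e + l)"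
      and l: "l < (n + e + 1) div 2"
    \<comment> \<open>This offset reads the first letter of block \<open>l\<close>. For
      \<open>e = 1\<close>, \<open>l = 0\<close> that letter lies outside the window, and truncated
      subtraction selects the second one instead.\<close>
    have "2 * l - e < n" "(e + (2 * l - e)) div 2 = l"
      using l assms by (auto simp: le_Suc_eq)
    then show "thue_morse (i + l) = thue_morse (j + l)"
      using * letter[of "e + (2 * l - e)"] by (metis add.assoc)
  next
    fix l
    assume *: "\<forall>l<(n + e + 1) div 2. thue_morse (i + l) = thue_morse (j + l)" and "l < n"
    then have "(e + l) div 2 < (n + e + 1) div 2" by presburger
    with * show "thue_morse (2 * i + e + l) = thue_morse (2 * j + e + l)"
      using letter[of "e + l"] by (simp add: add.assoc)
  qed
qed

section \<open>Counting factors by desubstitution and by their end letters\<close>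

lemma card_image_cong_kernel:
  assumes "\<And>x y. x \<in> A \<Longrightarrow> y \<in> A \<Longrightarrow> f x = f y \<longleftrightarrow> g x = g y"
  shows "card (f ` A) = card (g ` A)"
proof -
  have "\<exists>h. \<forall>x\<in>A. h (f x) = g x"
    by (rule exI[of _ "\<lambda>y. g (SOME x. x \<in> A \<and> f x = y)"])
      (metis (mono_tags, lifting) assms someI_ex)
  then obtain h where h: "\<And>x. x \<in> A \<Longrightarrow> h (f x) = g x" by blast
  have "inj_on h (f ` A)"
    by (auto simp: inj_on_def h assms)
  moreover have "h ` f ` A = g ` A"
    by (auto simp: image_image h)
  ultimately show ?thesis
    by (metis card_image)
qed

lemma finite_window_image [simp]: "finite ((\<lambda>i. window i n) ` A)"
  by (rule finite_subset[OF _ finite_tm_factors[of n]]) auto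

text \<open>By \<open>window_eq_parity\<close> no word occurs at both an even and an odd position,
  so the two kinds are counted separately after desubstitution. The set \<open>A\<close> is
  arbitrary so that conditions on end letters can be imposed.\<close>

lemma card_windows_split:
  assumes "5 \<le> n"
  shows "card ((\<lambda>i. window i n) ` A) =
    card ((\<lambda>i. window i ((n + 1) div 2)) ` {i. 2 * i \<in> A}) +
    card ((\<lambda>i. window i ((n + 2) div 2)) ` {i. Suc (2 * i) \<in> A})"
proof -
  let ?E = "(\<lambda>i. window (2 * i) n) ` {i. 2 * i \<in> A}"
  let ?O = "(\<lambda>i. window (Suc (2 * i)) n) ` {i. Suc (2 * i) \<in> A}"
  have "(\<lambda>i. window i n) ` A = ?E \<union> ?O"
    by (auto simp: image_iff) (metis evenE oddE Suc_eq_plus1)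
  moreover have "?E \<inter> ?O = {}"
    using window_eq_parity[OF _ assms] by fastforce
  moreover have "finite ?E" "finite ?O"
    by (rule finite_subset[OF _ finite_tm_factors[of n]]; auto)+
  ultimately have "card ((\<lambda>i. window i n) ` A) = card ?E + card ?O"
    by (simp add: card_Un_disjoint)
  also have "card ?E = card ((\<lambda>i. window i ((n + 1) div 2)) ` {i. 2 * i \<in> A})"
    using assms window_double_eq_iff[of 0 n] by (intro card_image_cong_kernel) simp
  also have "card ?O = card ((\<lambda>i. window i ((n + 2) div 2)) ` {i. Suc (2 * i) \<in> A})"
    using assms window_double_eq_iff[of 1 n] by (intro card_image_cong_kernel) simp
  finally show ?thesis .
qed

text \<open>
  Words of length \<open>n + 1\<close> are counted by \<open>n\<close>, the distance between their end letters, because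
  this makes the recursions below uniform.
\<close>

definition closed_count :: "nat \<Rightarrow> nat" where
  "closed_count n = card ((\<lambda>i. window i (Suc n)) ` {i. thue_morse i = thue_morse (i + n)})"

definition open_count :: "nat \<Rightarrow> nat" where
  "open_count n = card ((\<lambda>i. window i (Suc n)) ` {i. thue_morse i \<noteq> thue_morse (i + n)})"

lemma thue_morse_double_add:
  "thue_morse (2 * i + 2 * m) = thue_morse (i + m)"
  "thue_morse (Suc (2 * i + 2 * m)) = 1 - thue_morse (i + m)"
  "thue_morse (Suc (Suc (2 * i + 2 * m))) = thue_morse (Suc (i + m))"
  using thue_morse_double[of "i + m"] thue_morse_double_Suc[of "i + m"]
    thue_morse_double[of "Suc (i + m)"] by simp_all

lemma one_minus_thue_morse_eq_iff:
  "1 - thue_morse i = thue_morse j \<longleftrightarrow> thue_morse i \<noteq> thue_morse j"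
  "thue_morse i = 1 - thue_morse j \<longleftrightarrow> thue_morse i \<noteq> thue_morse j"
  "1 - thue_morse i = 1 - thue_morse j \<longleftrightarrow> thue_morse i = thue_morse j"
  using thue_morse_le_1[of i] thue_morse_le_1[of j] by (auto simp: le_Suc_eq)

text \<open>End positions at even distance have the same parity, so desubstitution preserves whether
  the end letters agree. At odd distance exactly one end letter is complemented, which swaps the two
  counts. The assumption makes all words at least five letters long.\<close>

lemma end_counts_rec:
  assumes "2 \<le> m"
  shows closed_count_double: "closed_count (2 * m) = 2 * closed_count m"
    and open_count_double: "open_count (2 * m) = 2 * open_count m"
    and closed_count_double_Suc: "closed_count (Suc (2 * m)) = open_count m + open_count (Suc m)"
    and open_count_double_Suc: "open_count (Suc (2 * m)) = closed_count m + closed_count (Suc m)"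
  using assms
  by (simp_all add: closed_count_def open_count_def card_windows_split thue_morse_double_add
      thue_morse_double thue_morse_double_Suc one_minus_thue_morse_eq_iff[simplified])

lemma card_tm_factors_Suc: "card (tm_factors (Suc n)) = closed_count n + open_count n"
proof -
  let ?C = "(\<lambda>i. window i (Suc n)) ` {i. thue_morse i = thue_morse (i + n)}"
  let ?O = "(\<lambda>i. window i (Suc n)) ` {i. thue_morse i \<noteq> thue_morse (i + n)}"
  have "tm_factors (Suc n) = ?C \<union> ?O"
    by (auto simp: tm_factors_eq)
  moreover have "?C \<inter> ?O = {}"
    by (auto simp: window_eq_iff) (metis add_0_right lessI zero_less_Suc)
  ultimately show ?thesis
    by (simp add: card_Un_disjoint closed_count_def open_count_def)
qed

section \<open>Initial values of the end counts\<close>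

lemma thue_morse_numeral [simp]:
  "thue_morse 0 = 0"
  "thue_morse (Suc 0) = 1"
  "thue_morse (numeral (Num.Bit0 k)) = thue_morse (numeral k)"
  "thue_morse (numeral (Num.Bit1 k)) = 1 - thue_morse (numeral k)"
  using thue_morse_double_Suc[of 0] thue_morse_double[of "numeral k"]
    thue_morse_double_Suc[of "numeral k"]
  by (simp_all add: thue_morse_def[of 0] numeral_Bit0 numeral_Bit1 mult_2)

lemma thue_morse_cases: "thue_morse i = 0 \<or> thue_morse i = Suc 0"
  using thue_morse_le_1[of i] by (auto simp: le_Suc_eq)

lemma window_3: "window i (Suc 2) = [thue_morse i, thue_morse (Suc i), thue_morse (Suc (Suc i))]"
  by (simp add: window_Suc numeral_eq_Suc)

lemma window_4:
  "window i (Suc 3) = [thue_morse i, thue_morse (Suc i), thue_morse (Suc (Suc i)),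
    thue_morse (Suc (Suc (Suc i)))]"
  by (simp add: window_Suc numeral_eq_Suc)

lemma closed_count_2: "closed_count 2 = 2"
proof -
  let ?A = "{i. thue_morse i = thue_morse (i + 2)}"
  let ?f = "\<lambda>i. [thue_morse i, thue_morse (Suc i), thue_morse (Suc (Suc i))]"
  have "(\<lambda>i. window i (Suc 2)) ` ?A = {[0,1,0], [1,0,1]}"
    unfolding window_3
  proof (intro equalityI image_subsetI)
    fix i assume "i \<in> ?A"
    then show "?f i \<in> {[0,1,0], [1,0,1]}"
      using thue_morse_cube_free[of i] thue_morse_cases[of i] thue_morse_cases[of "Suc i"]
      by auto
  next
    \<comment> \<open>The numbers are positions where the listed words occur, evaluated by
      \<open>thue_morse_numeral\<close>; likewise in the next three lemmas.\<close>
    have "{[0,1,0], [1,0,1]} = ?f ` {3,2}"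
      by simp
    also have "\<dots> \<subseteq> ?f ` ?A"
      by (rule image_mono) simp
    finally show "{[0,1,0], [1,0,1]} \<subseteq> ?f ` ?A" .
  qed
  then show ?thesis by (simp add: closed_count_def)
qed

lemma open_count_2: "open_count 2 = 4"
proof -
  let ?A = "{i. thue_morse i \<noteq> thue_morse (i + 2)}"
  let ?f = "\<lambda>i. [thue_morse i, thue_morse (Suc i), thue_morse (Suc (Suc i))]"
  have "(\<lambda>i. window i (Suc 2)) ` ?A =
      {[0,0,1], [0,1,1], [1,0,0], [1,1,0]}"
    unfolding window_3
  proof (intro equalityI image_subsetI)
    fix i assume "i \<in> ?A"
    then show "?f i \<in> {[0,0,1], [0,1,1], [1,0,0], [1,1,0]}"
      using thue_morse_cases[of i] thue_morse_cases[of "Suc i"] thue_morse_cases[of "Suc (Suc i)"]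
      by auto
  next
    have "{[0,0,1], [0,1,1], [1,0,0], [1,1,0]} = ?f ` {5,12,4,13}"
      by simp
    also have "\<dots> \<subseteq> ?f ` ?A"
      by (rule image_mono) simp
    finally show "{[0,0,1], [0,1,1], [1,0,0], [1,1,0]} \<subseteq> ?f ` ?A" .
  qed
  then show ?thesis by (simp add: open_count_def)
qed

lemma closed_count_3: "closed_count 3 = 6"
proof -
  let ?A = "{i. thue_morse i = thue_morse (i + 3)}"
  let ?f = "\<lambda>i. [thue_morse i, thue_morse (Suc i), thue_morse (Suc (Suc i)),
    thue_morse (Suc (Suc (Suc i)))]"
  have "(\<lambda>i. window i (Suc 3)) ` ?A =
      {[0,1,1,0], [1,0,0,1], [0,1,0,0], [0,0,1,0], [1,0,1,1], [1,1,0,1]}"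
    unfolding window_4
  proof (intro equalityI image_subsetI)
    fix i assume "i \<in> ?A"
    then show "?f i \<in>
        {[0,1,1,0], [1,0,0,1], [0,1,0,0], [0,0,1,0], [1,0,1,1], [1,1,0,1]}"
      using thue_morse_cases[of i] thue_morse_cases[of "Suc i"] thue_morse_cases[of "Suc (Suc i)"]
        thue_morse_cube_free[of i] thue_morse_cube_free[of "Suc i"]
      by (elim disjE; simp add: numeral_3_eq_3)
  next
    have "{[0,1,1,0], [1,0,0,1], [0,1,0,0], [0,0,1,0], [1,0,1,1], [1,1,0,1]} = ?f ` {12,4,3,9,11,13}"
      by simp
    also have "\<dots> \<subseteq> ?f ` ?A"
      by (rule image_mono) simp
    finally show "{[0,1,1,0], [1,0,0,1], [0,1,0,0], [0,0,1,0], [1,0,1,1], [1,1,0,1]} \<subseteq> ?f ` ?A" .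
  qed
  then show ?thesis by (simp add: closed_count_def)
qed

lemma open_count_3: "open_count 3 = 4"
proof -
  let ?A = "{i. thue_morse i \<noteq> thue_morse (i + 3)}"
  let ?f = "\<lambda>i. [thue_morse i, thue_morse (Suc i), thue_morse (Suc (Suc i)),
    thue_morse (Suc (Suc (Suc i)))]"
  have "(\<lambda>i. window i (Suc 3)) ` ?A =
      {[0,0,1,1], [1,1,0,0], [0,1,0,1], [1,0,1,0]}"
    unfolding window_4
  proof (intro equalityI image_subsetI)
    fix i assume "i \<in> ?A"
    then show "?f i \<in> {[0,0,1,1], [1,1,0,0], [0,1,0,1], [1,0,1,0]}"
      using thue_morse_cases[of i] thue_morse_cases[of "Suc i"] thue_morse_cases[of "Suc (Suc i)"]
        thue_morse_cases[of "i + 3"]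
        thue_morse_cube_free[of i] thue_morse_cube_free[of "Suc i"]
      by (elim disjE; simp add: numeral_3_eq_3)
  next
    have "{[0,0,1,1], [1,1,0,0], [0,1,0,1], [1,0,1,0]} = ?f ` {5,7,10,2}"
      by simp
    also have "\<dots> \<subseteq> ?f ` ?A"
      by (rule image_mono) simp
    finally show "{[0,0,1,1], [1,1,0,0], [0,1,0,1], [1,0,1,0]} \<subseteq> ?f ` ?A" .
  qed
  then show ?thesis by (simp add: open_count_def)
qed

section \<open>Linear bounds on the end counts\<close>

text \<open>A single odd step bounds \<open>open_count\<close> only through the weak bound on
  \<open>closed_count\<close>. Two steps turn it into open counts at \<open>k\<close> and
  \<open>Suc k\<close> plus twice the closed count at one of them; there 3 open + 6 closed = 3 (open
  + closed) + 3 closed, which the joint hypotheses bound by 12 times the argument.\<close>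

lemma end_counts_lower_bound:
  assumes "2 \<le> n"
  shows "n \<le> closed_count n \<and> 4 * n \<le> 3 * open_count n \<and> 3 * n \<le> closed_count n + open_count n"
  using assms
proof (induction n rule: less_induct)
  case (less n)
  note IH = less.IH
  \<comment> \<open>The lengths 5 and 7 would have \<open>k = 1\<close>, below the range of the
    recursion.\<close>
  consider "n = 2" | "n = 3" | "n = 5" | "n = 7"
    | m where "n = 2 * m" "2 \<le> m"
    | k where "n = Suc (2 * (2 * k))" "2 \<le> k" | k where "n = Suc (2 * (Suc (2 * k)))" "2 \<le> k"
  proof -
    have "n = 2 * (n div 2) \<or> n = Suc (2 * (2 * (n div 4))) \<or> n = Suc (2 * (Suc (2 * (n div 4))))"
      by presburger
    moreover have "n < 8 \<Longrightarrow> n = 2 \<or> n = 3 \<or> n = 4 \<or> n = 5 \<or> n = 6 \<or> n = 7"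
      using less.prems by auto
    ultimately show ?thesis
      using that less.prems by (cases "n < 8") fastforce+
  qed
  then show ?case
  proof cases
    case 3
    then show ?thesis
      using open_count_double_Suc[of 2] closed_count_double_Suc[of 2]
      by (simp add: closed_count_2 open_count_2 closed_count_3 open_count_3)
  next
    case 4
    then show ?thesis
      using open_count_double_Suc[of 3] closed_count_double_Suc[of 3] end_counts_rec(1,2)[of 2]
      by (simp add: closed_count_2 open_count_2 closed_count_3 open_count_3)
  next
    case (5 m)
    then show ?thesis
      using IH[of m] by (simp add: end_counts_rec)
  next
    case (6 k)
    then show ?thesis
      using IH[of k] IH[of "Suc k"] closed_count_double_Suc[of "2 * k"]
        open_count_double_Suc[of "2 * k"] by (auto simp: end_counts_rec)
  next
    case (7 k)
    then have "closed_count (Suc (Suc (2 * k))) = 2 * closed_count (Suc k)"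
      "open_count (Suc (Suc (2 * k))) = 2 * open_count (Suc k)"
      using closed_count_double[of "Suc k"] open_count_double[of "Suc k"] by simp_all
    then show ?thesis
      using 7 IH[of k] IH[of "Suc k"] closed_count_double_Suc[of "Suc (2 * k)"]
        open_count_double_Suc[of "Suc (2 * k)"]
      by (auto simp: end_counts_rec)
  qed (simp_all add: closed_count_2 open_count_2 closed_count_3 open_count_3)
qed

text \<open>The sum S of both end counts satisfies S(2m) = 2 S(m) and S(2m + 1) = S(m) + S(m + 1),
  so both increments after 2m and 2m + 1 equal the increment after m.\<close>

lemma card_tm_factors_Suc_le:
  assumes "3 \<le> n"
  shows "card (tm_factors (Suc n)) \<le> card (tm_factors n) + 4"
proof -
  have "closed_count (Suc n) + open_count (Suc n) \<le> closed_count n + open_count n + 4"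
    if "2 \<le> n" for n
    using that
  proof (induction n rule: less_induct)
    case (less n)
    consider "n = 2" | "n = 3" | m where "n = 2 * m" "2 \<le> m" | m where "n = Suc (2 * m)" "2 \<le> m"
    proof -
      have "n = 2 * (n div 2) \<or> n = Suc (2 * (n div 2))"
        by presburger
      moreover have "n < 4 \<Longrightarrow> n = 2 \<or> n = 3"
        using less.prems by auto
      ultimately show ?thesis
        using that less.prems by (cases "n < 4") fastforce+
    qed
    then show ?case
    proof cases
      case 2
      then show ?thesis
        using end_counts_rec(1,2)[of 2]
        by (simp add: closed_count_2 open_count_2 closed_count_3 open_count_3)
    next
      case (3 m)
      then show ?thesis
        using less.IH[of m] by (simp add: end_counts_rec)
    next
      case (4 m)
      moreover have "Suc (Suc (2 * m)) = 2 * Suc m" by simp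
      ultimately show ?thesis
        using less.IH[of m] by (simp add: end_counts_rec del: mult_Suc_right)
    qed (simp add: closed_count_2 open_count_2 closed_count_3 open_count_3)
  qed
  from this[of "n - 1"] show ?thesis
    using assms by (cases n) (auto simp: card_tm_factors_Suc)
qed

text \<open>The lower bound is attained at 3, and doubling preserves equality. The start 12 already
  lies in the range of \<open>cyclic_complexity_double\<close>.\<close>

lemma open_count_12_power: "open_count (12 * 2 ^ k) = 16 * 2 ^ k"
proof (induction k)
  case 0
  then show ?case
    using open_count_double[of 3] open_count_double[of 6] by (simp add: open_count_3)
next
  case (Suc k)
  moreover have "(2::nat) \<le> 12 * 2 ^ k"
    using one_le_power[of "2::nat" k] by linarith
  ultimately show ?case
    using open_count_double[of "12 * 2 ^ k"] by (simp add: algebra_simps)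
qed

section \<open>Conjugate windows\<close>

lemma cyclic_equiv_iff_rotate: "(x, y) \<in> cyclic_equiv \<longleftrightarrow> (\<exists>k. y = rotate k x)"
proof
  assume "(x, y) \<in> cyclic_equiv"
  then show "\<exists>k. y = rotate k x"
    unfolding cyclic_equiv_def by (auto intro: rotate_append [symmetric])
next
  assume "\<exists>k. y = rotate k x"
  then show "(x, y) \<in> cyclic_equiv"
    unfolding cyclic_equiv_def by (auto simp: rotate_drop_take intro!: append_take_drop_id [symmetric])
qed

lemma cyclic_class_eq_iff:
  "cyclic_equiv `` {x} = cyclic_equiv `` {y} \<longleftrightarrow> (\<exists>k. y = rotate k x)"
  using eq_equiv_class_iff[OF equiv_cyclic_equiv, of x y] by (simp add: cyclic_equiv_iff_rotate)

lemma cyclic_class_eqE: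
  assumes "cyclic_equiv `` {x} = cyclic_equiv `` {y}" "x \<noteq> []"
  obtains k where "k < length x" "y = rotate k x"
proof -
  obtain k where "y = rotate k x" using assms(1) cyclic_class_eq_iff by blast
  then have "y = rotate (k mod length x) x" using rotate_conv_mod by metis
  then show ?thesis using that[of "k mod length x"] assms(2) by simp
qed

lemma cyclic_complexity_eq:
  "cyclic_complexity n = card ((\<lambda>x. cyclic_equiv `` {x}) ` tm_factors n)"
  by (simp add: cyclic_complexity_def quotient_def UNION_singleton_eq_range)

lemma window_append: "window i m @ window (i + m) n = window i (m + n)"
  by (rule nth_equalityI) (auto simp: nth_append)

lemma rotate_window_eq_windowD:
  assumes "rotate k (window i n) = window j n" "k < n"
  shows "window (i + k) (n - k) = window j (n - k)" "window i k = window (j + (n - k)) k"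
proof -
  have "rotate k (window i n) = window (i + k) (n - k) @ window i k"
    using assms(2) by (simp add: rotate_drop_take drop_window take_window)
  moreover have "window j n = window j (n - k) @ window (j + (n - k)) k"
    using window_append[of j "n - k" k] assms(2) by simp
  ultimately show "window (i + k) (n - k) = window j (n - k)" "window i k = window (j + (n - k)) k"
    using assms(1) by simp_all
qed

text \<open>Rotation cuts the window into two pieces that recur in the other window in swapped
  order. Each piece of at least five letters has the same position parity in both.\<close>

lemma rotate_window_parity:
  assumes "rotate k (window i n) = window j n" "k < n"
  shows "5 \<le> n - k \<Longrightarrow> even (i + k) \<longleftrightarrow> even j"
    and "5 \<le> k \<Longrightarrow> even (i + k) \<longleftrightarrow> even (j + n)"
  using rotate_window_eq_windowD[OF assms, THEN window_eq_parity] assms(2) by auto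

text \<open>
  On a cyclic word of odd length two distant cutting points would impose contradictory parities
  on the squares of letters.
\<close>
lemma rotate_window_odd:
  assumes "rotate k (window i n) = window j n" "k < n" "odd n"
  shows "k \<le> 4 \<or> n - k \<le> 4"
proof (rule ccontr)
  assume "\<not> ?thesis"
  then show False
    using rotate_window_parity[OF assms(1,2)] assms(3) by auto
qed

section \<open>Right special factors and odd lengths\<close>

definition right_special :: "nat \<Rightarrow> nat list set" where
  "right_special n = {x. x @ [0] \<in> tm_factors (Suc n) \<and> x @ [1] \<in> tm_factors (Suc n)}"

text \<open>Every factor extends to the right by one or two letters, so the increment of the factor
  count is the number of factors with two extensions.\<close>

lemma card_right_special:
  "finite (right_special n)"
  "card (right_special n) + card (tm_factors n) = card (tm_factors (Suc n))"
proof -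
  define A where "A a = {x. x @ [a] \<in> tm_factors (Suc n)}" for a
  have img: "tm_factors (Suc n) = (\<lambda>x. x @ [0]) ` A 0 \<union> (\<lambda>x. x @ [1]) ` A 1"
  proof (intro equalityI subsetI)
    fix x assume "x \<in> tm_factors (Suc n)"
    then obtain i where "x = window i n @ [thue_morse (i + n)]"
      by (auto simp: tm_factors_eq window_Suc_right)
    then show "x \<in> (\<lambda>x. x @ [0]) ` A 0 \<union> (\<lambda>x. x @ [1]) ` A 1"
      using \<open>x \<in> tm_factors (Suc n)\<close> thue_morse_cases[of "i + n"] by (auto simp: A_def)
  qed (auto simp: A_def)
  have fin: "finite (A a)" for a
  proof (rule finite_imageD[of "\<lambda>x. x @ [a]"])
    show "finite ((\<lambda>x. x @ [a]) ` A a)"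
      by (rule finite_subset[OF _ finite_tm_factors[of "Suc n"]]) (auto simp: A_def)
  qed (auto simp: inj_on_def)
  have Un: "tm_factors n = A 0 \<union> A 1"
  proof (intro equalityI subsetI)
    fix x assume "x \<in> tm_factors n"
    then obtain i where i: "x = window i n"
      by (auto simp: tm_factors_eq)
    then have "x @ [thue_morse (i + n)] \<in> tm_factors (Suc n)"
      by (simp flip: window_Suc_right)
    then show "x \<in> A 0 \<union> A 1"
      using thue_morse_cases[of "i + n"] by (auto simp: A_def)
  next
    fix x assume "x \<in> A 0 \<union> A 1"
    then obtain i a where "x @ [a] = window i n @ [thue_morse (i + n)]"
      by (auto simp: A_def tm_factors_eq window_Suc_right)
    then show "x \<in> tm_factors n" by simp
  qed
  have Int: "right_special n = A 0 \<inter> A 1"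
    by (auto simp: right_special_def A_def)
  show "finite (right_special n)" using fin Int by simp
  have "card (tm_factors (Suc n)) = card ((\<lambda>x. x @ [0]) ` A 0) + card ((\<lambda>x. x @ [1]) ` A 1)"
    unfolding img by (rule card_Un_disjoint) (auto simp: fin)
  also have "\<dots> = card (A 0) + card (A 1)"
    by (simp add: card_image inj_on_def)
  also have "\<dots> = card (right_special n) + card (tm_factors n)"
    unfolding Int Un using card_Un_Int[OF fin fin, of 0 1] by simp
  finally show "card (right_special n) + card (tm_factors n) = card (tm_factors (Suc n))" ..
qed

lemma right_specialI:
  assumes "window i n = window j n" "thue_morse (i + n) \<noteq> thue_morse (j + n)"
  shows "window i n \<in> right_special n"
proof -
  have "window i n @ [thue_morse (i + n)] \<in> tm_factors (Suc n)"
    "window i n @ [thue_morse (j + n)] \<in> tm_factors (Suc n)"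
    using window_in_tm_factors[of i "Suc n"] window_in_tm_factors[of j "Suc n"]
    by (simp_all add: window_Suc_right assms(1))
  then show ?thesis
    using assms(2) thue_morse_cases[of "i + n"] thue_morse_cases[of "j + n"]
    by (auto simp: right_special_def)
qed

text \<open>
  Apart from boundedly many right special factors, a factor \<open>au\<close> with a conjugate factor nearby
  extends to a factor \<open>aua\<close>. The other factors are pairwise non-conjugate.
\<close>
lemma cyclic_complexity_odd_ge:
  assumes "odd n" "8 \<le> n"
  shows "open_count n \<le> cyclic_complexity n + 68"
proof -
  define F where "F = {x \<in> tm_factors n. \<forall>k\<in>{1..4}. rotate k x \<notin> tm_factors n}"
  let ?C = "(\<lambda>i. window i (Suc n)) ` {i. thue_morse i = thue_morse (i + n)}"
  let ?L = "{xs :: nat list. set xs \<subseteq> {0, 1} \<and> length xs = 4}"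
  have "inj_on (\<lambda>x. cyclic_equiv `` {x}) F"
  proof (rule inj_onI, rule ccontr)
    fix x y assume xy: "x \<in> F" "y \<in> F" "cyclic_equiv `` {x} = cyclic_equiv `` {y}" "x \<noteq> y"
    obtain i j where w: "x = window i n" "y = window j n"
      using xy(1,2) by (auto simp: F_def tm_factors_eq)
    have "x \<noteq> []" using w(1) assms(2) by (auto simp flip: length_0_conv)
    then obtain k where k: "k < n" "y = rotate k x"
      using cyclic_class_eqE[OF xy(3)] w by auto
    then have "k \<le> 4 \<or> n - k \<le> 4"
      using rotate_window_odd assms(1) w by metis
    moreover have "k \<noteq> 0" using k(2) xy(4) by (metis rotate0 id_apply)
    \<comment> \<open>Either \<open>y\<close> is a short rotation of \<open>x\<close>, or
      \<open>x\<close> is one of \<open>y\<close>; both are excluded by membership in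
      \<open>F\<close>.\<close>
    ultimately have "k \<in> {1..4} \<or> n - k \<in> {1..4}"
      using k(1) by auto
    moreover have "x = rotate (n - k) y"
      using k w(1) rotate_conv_mod[of n x] by (simp add: rotate_rotate)
    moreover have "x \<in> tm_factors n" "y \<in> tm_factors n"
      and "\<And>l. l \<in> {1..4} \<Longrightarrow> rotate l x \<notin> tm_factors n"
      and "\<And>l. l \<in> {1..4} \<Longrightarrow> rotate l y \<notin> tm_factors n"
      using xy(1,2) by (simp_all add: F_def)
    ultimately show False
      using k(2) by metis
  qed
  then have "card F = card ((\<lambda>x. cyclic_equiv `` {x}) ` F)"
    by (simp add: card_image)
  also have "\<dots> \<le> cyclic_complexity n"
    unfolding cyclic_complexity_eq by (rule card_mono) (auto simp: F_def finite_tm_factors)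
  finally have F: "card F \<le> cyclic_complexity n" .
  have fin: "finite F" "finite ?L"
    by (auto simp: F_def finite_tm_factors finite_lists_length_eq)
  have "tm_factors n \<subseteq> F \<union> (butlast ` ?C \<union> (\<lambda>(u, v). u @ v) ` (?L \<times> right_special (n - 4)))"
  proof
    fix x assume x: "x \<in> tm_factors n"
    then obtain i where i: "x = window i n" by (auto simp: tm_factors_eq)
    show "x \<in> F \<union> (butlast ` ?C \<union> (\<lambda>(u, v). u @ v) ` (?L \<times> right_special (n - 4)))"
    proof (cases "x \<in> F \<or> thue_morse i = thue_morse (i + n)")
      case True
      moreover have "x = butlast (window i (Suc n))"
        by (simp add: i window_Suc_right)
      ultimately show ?thesis by blast
    next
      case False
      then obtain k j where k: "1 \<le> k" "k \<le> 4" "rotate k x = window j n"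
        using x by (auto simp: F_def tm_factors_eq)
      have "k < n" using k assms by simp
      note rot = rotate_window_eq_windowD[OF k(3)[unfolded i] this]
      \<comment> \<open>The part of \<open>x\<close> after its first four letters recurs at
        \<open>j + (4 - k)\<close>, followed there by the letter at \<open>i\<close> rather than the
        different letter at \<open>i + n\<close>. Cutting off four letters instead of
        \<open>k\<close> makes the length independent of \<open>k\<close>.\<close>
      have "window (i + 4) (n - 4) = window (j + (4 - k)) (n - 4)"
        using arg_cong[OF rot(1), of "drop (4 - k)"] k by (simp add: drop_window)
      moreover have "thue_morse (j + (4 - k) + (n - 4)) = thue_morse i"
        using arg_cong[OF rot(2), of hd] k assms
        by (cases k) (auto simp: window_Suc add_ac)
      ultimately have "window (i + 4) (n - 4) \<in> right_special (n - 4)"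
        using False assms by (intro right_specialI) auto
      moreover have "x = window i 4 @ window (i + 4) (n - 4)"
        using assms by (simp add: i window_append)
      moreover have "window i 4 \<in> ?L"
        using thue_morse_cases by (auto simp: window_def) (metis less_numeral_extra(3))
      ultimately show ?thesis by blast
    qed
  qed
  then have "card (tm_factors n) \<le>
      card (F \<union> (butlast ` ?C \<union> (\<lambda>(u, v). u @ v) ` (?L \<times> right_special (n - 4))))"
    by (rule card_mono[rotated])
      (intro finite_UnI finite_imageI finite_cartesian_product fin card_right_special
        finite_window_image)
  also have "\<dots> \<le> card F +
      (card (butlast ` ?C) + card ((\<lambda>(u, v). u @ v) ` (?L \<times> right_special (n - 4))))"
    by (intro order.trans[OF card_Un_le] add_mono order.refl card_Un_le)
  also have "card (butlast ` ?C) \<le> closed_count n"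
    unfolding closed_count_def by (rule card_image_le) simp
  also have "card ((\<lambda>(u, v). u @ v) ` (?L \<times> right_special (n - 4))) \<le>
      card (?L \<times> right_special (n - 4))"
    by (intro card_image_le finite_cartesian_product fin card_right_special)
  also have "\<dots> \<le> 16 * 4"
  proof -
    have "3 \<le> n - 4" using assms(2) by simp
    then have "card (right_special (n - 4)) \<le> 4"
      using card_right_special(2)[of "n - 4"] card_tm_factors_Suc_le[of "n - 4"] by linarith
    moreover have "card ?L = 16"
      by (subst card_lists_length_eq) (auto simp: card_insert_if eval_nat_numeral)
    ultimately show ?thesis by (simp add: card_cartesian_product)
  qed
  finally have "card (tm_factors n) \<le> cyclic_complexity n + closed_count n + 64"
    using F by simp
  \<comment> \<open>The increment 4 from length \<open>n\<close> to \<open>Suc n\<close>, added to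
    64 = 16 * 4 (prefixes times right special factors), gives the constant 68.\<close>
  moreover have "closed_count n + open_count n \<le> card (tm_factors n) + 4"
    using card_tm_factors_Suc_le[of n] assms by (simp flip: card_tm_factors_Suc)
  ultimately show ?thesis by simp
qed

section \<open>Even lengths\<close>

text \<open>One of the two pieces has at least five letters, and for even \<open>n\<close> both
  pieces give the same parity condition.\<close>

lemma rotate_window_even:
  assumes "rotate k (window i n) = window j n" "k < n" "even n" "10 \<le> n"
  shows "even (i + k) \<longleftrightarrow> even j"
proof (cases "5 \<le> k")
  case True
  then show ?thesis using rotate_window_parity(2)[OF assms(1,2)] assms(3) by simp
next
  case False
  then show ?thesis using rotate_window_parity(1)[OF assms(1,2)] assms(4) by simp
qed

text \<open>
  The square of letters formed by the two ends fixes the cutting point of the cyclic word: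
  all other pairs of neighbours at that parity are distinct.
\<close>
lemma rotate_closed_window_odd_start:
  assumes rot: "rotate k (window i n) = window j n" "k < n" "even n" "10 \<le> n"
    and "odd i" "thue_morse i = thue_morse (i + (n - 1))"
  shows "k = 0"
proof (rule ccontr)
  assume "k \<noteq> 0"
  \<comment> \<open>In the second window the last and the first letter of the first one meet at
    positions \<open>q\<close> and \<open>Suc q\<close>.\<close>
  define q where "q = j + (n - k) - 1"
  have q: "j + (n - k) = Suc q" using rot(2) by (simp add: q_def)
  note D = rotate_window_eq_windowD[OF rot(1,2), unfolded window_eq_iff]
  have "thue_morse (i + (n - 1)) = thue_morse q"
    using D(1)[rule_format, of "n - k - 1"] rot(2) by (simp add: q_def)
  moreover have "thue_morse i = thue_morse (Suc q)"
    using D(2)[rule_format, of 0] \<open>k \<noteq> 0\<close> by (simp add: q)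
  ultimately have "odd q"
    using assms(6) odd_if_thue_morse_eq_Suc by simp
  then have "even (j + (n - k))" using q by simp
  then show False
    using rotate_window_even[OF rot] rot(2,3) \<open>odd i\<close> by auto
qed

text \<open>The Thue-Morse morphism, called \<open>\<mu>\<close> in the proof, is injective and
  turns rotation by \<open>k\<close> into rotation by \<open>2 * k\<close>.\<close>

lemma rotate_window_double:
  "rotate (2 * k) (window (2 * i) (2 * n)) = window (2 * j) (2 * n) \<longleftrightarrow>
    rotate k (window i n) = window j n"
proof -
  define \<mu> :: "nat list \<Rightarrow> nat list" where "\<mu> = (\<lambda>w. concat (map (\<lambda>a. [a, 1 - a]) w))"
  have win: "window (2 * i) (2 * n) = \<mu> (window i n)" for i
  proof (induction n arbitrary: i)
    case (Suc n)
    show ?case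
      using Suc[of "Suc i"]
      by (simp add: window_Suc \<mu>_def thue_morse_double thue_morse_double_Suc)
  qed (simp add: \<mu>_def)
  have rot: "rotate (2 * k) (\<mu> w) = \<mu> (rotate k w)" for w
  proof (induction k)
    case (Suc k)
    have "rotate1 (rotate1 (\<mu> w)) = \<mu> (rotate1 w)" for w
      by (cases w) (simp_all add: \<mu>_def)
    then show ?case using Suc by (simp add: rotate_Suc)
  qed simp
  have "v = w" if "\<mu> v = \<mu> w" for v w
    using that
  proof (induction v arbitrary: w)
    case (Cons a v)
    then show ?case by (cases w) (auto simp: \<mu>_def)
  qed (cases w; simp add: \<mu>_def)
  then show ?thesis
    unfolding win rot by auto
qed

lemma cyclic_complexity_double:
  assumes "5 \<le> n"
  shows "cyclic_complexity (2 * n) = cyclic_complexity n + open_count n"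
proof -
  define cls :: "nat list \<Rightarrow> nat list set" where "cls x = cyclic_equiv `` {x}" for x
  \<comment> \<open>The window of length \<open>2 * n\<close> at \<open>Suc (2 * i)\<close> has end
    letters \<open>1 - thue_morse i\<close> and \<open>thue_morse (i + n)\<close>, which agree
    exactly for \<open>i\<close> in this set.\<close>
  let ?I = "{i. thue_morse i \<noteq> thue_morse (i + n)}"
  let ?A = "range (\<lambda>i. cls (window (2 * i) (2 * n)))"
  let ?B = "(\<lambda>i. cls (window (Suc (2 * i)) (2 * n))) ` ?I"
  have cls_eqE: "\<exists>k<2 * n. rotate k (window i (2 * n)) = window j (2 * n)"
    if "cls (window i (2 * n)) = cls (window j (2 * n))" for i j
    using that[unfolded cls_def] assms
    by (elim cyclic_class_eqE) (auto simp flip: length_0_conv)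
  have start: "k = 0"
    if "rotate k (window (Suc (2 * i)) (2 * n)) = window j (2 * n)" "k < 2 * n" "i \<in> ?I" for k i j
  proof (rule rotate_closed_window_odd_start[OF that(1,2)])
    have "Suc (2 * i) + (2 * n - 1) = 2 * (i + n)" using assms by simp
    then show "thue_morse (Suc (2 * i)) = thue_morse (Suc (2 * i) + (2 * n - 1))"
      using that(3) thue_morse_neq_iff[of "i + n" i]
      by (simp only: thue_morse_double thue_morse_double_Suc) auto
  qed (use assms in auto)
  have cls_B: "window (Suc (2 * i)) (2 * n) = window j (2 * n)"
    if eq: "cls (window (Suc (2 * i)) (2 * n)) = cls (window j (2 * n))" and i: "i \<in> ?I" for i j
  proof -
    obtain k where "k < 2 * n" "rotate k (window (Suc (2 * i)) (2 * n)) = window j (2 * n)"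
      using cls_eqE[OF eq] by blast
    with start[of k i j] i show ?thesis by simp
  qed
  have "cls ` tm_factors (2 * n) = ?A \<union> ?B"
  proof (intro equalityI subsetI)
    fix c assume "c \<in> cls ` tm_factors (2 * n)"
    then obtain i where c: "c = cls (window i (2 * n))" by (auto simp: tm_factors_eq)
    consider m where "i = 2 * m" | m where "i = Suc (2 * m)" "m \<in> ?I"
      | m where "i = Suc (2 * m)" "m \<notin> ?I"
    proof (cases "even i")
      case False
      then obtain m where "i = Suc (2 * m)" by (auto elim: oddE)
      then show ?thesis using that by blast
    qed (use that in blast)
    then show "c \<in> ?A \<union> ?B"
    proof cases
      \<comment> \<open>Here the letter at \<open>2 * m\<close> equals the last letter of the window
        at \<open>Suc (2 * m)\<close>, so that window is the even one rotated by one letter.\<close>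
      case (3 m)
      obtain N where N: "2 * n = Suc N" using assms by (cases "2 * n") auto
      have "Suc (2 * m) + N = 2 * (m + n)" using N by simp
      then have "rotate1 (window (2 * m) (2 * n)) = window i (2 * n)"
        using 3 thue_morse_double[of "m + n"] thue_morse_double[of m]
        by (simp add: N window_Suc[of "2 * m"] window_Suc_right[of "Suc (2 * m)"])
      then have "cls (window (2 * m) (2 * n)) = c"
        unfolding c cls_def cyclic_class_eq_iff by (metis rotate_Suc rotate0 id_apply)
      then show ?thesis by blast
    qed (auto simp: c)
  qed (auto simp: tm_factors_eq)
  moreover have "?A \<inter> ?B = {}"
  proof (rule ccontr)
    assume "?A \<inter> ?B \<noteq> {}"
    then obtain i j where "i \<in> ?I" "cls (window (Suc (2 * i)) (2 * n)) = cls (window (2 * j) (2 * n))"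
      by auto
    then have "window (Suc (2 * i)) (2 * n) = window (2 * j) (2 * n)"
      by (intro cls_B)
    then show False using window_eq_parity assms by fastforce
  qed
  moreover have "finite (cls ` tm_factors (2 * n))"
    by (simp add: finite_tm_factors)
  ultimately have "cyclic_complexity (2 * n) = card ?A + card ?B"
    unfolding cyclic_complexity_eq cls_def[symmetric] by (simp add: card_Un_disjoint)
  also have "card ?A = card (range (\<lambda>i. cls (window i n)))"
  proof (rule card_image_cong_kernel)
    fix i j
    show "cls (window (2 * i) (2 * n)) = cls (window (2 * j) (2 * n)) \<longleftrightarrow>
        cls (window i n) = cls (window j n)"
    proof
      assume "cls (window (2 * i) (2 * n)) = cls (window (2 * j) (2 * n))"
      then obtain k where k: "k < 2 * n" "rotate k (window (2 * i) (2 * n)) = window (2 * j) (2 * n)"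
        using cls_eqE by blast
      then have "even k" using rotate_window_even[OF k(2,1)] assms by simp
      then obtain l where "k = 2 * l" by blast
      with k have "rotate l (window i n) = window j n"
        using rotate_window_double by simp
      then show "cls (window i n) = cls (window j n)"
        unfolding cls_def cyclic_class_eq_iff by metis
    next
      assume "cls (window i n) = cls (window j n)"
      then obtain k where "rotate k (window i n) = window j n"
        unfolding cls_def cyclic_class_eq_iff by metis
      then show "cls (window (2 * i) (2 * n)) = cls (window (2 * j) (2 * n))"
        unfolding cls_def cyclic_class_eq_iff using rotate_window_double by metis
    qed
  qed
  also have "\<dots> = cyclic_complexity n"
    by (simp add: cyclic_complexity_eq tm_factors_eq image_image cls_def)
  also have "card ?B = card ((\<lambda>i. window i (Suc n)) ` ?I)"
  proof (rule card_image_cong_kernel)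
    fix i j assume "i \<in> ?I" "j \<in> ?I"
    have "cls (window (Suc (2 * i)) (2 * n)) = cls (window (Suc (2 * j)) (2 * n)) \<longleftrightarrow>
        window (Suc (2 * i)) (2 * n) = window (Suc (2 * j)) (2 * n)"
      using cls_B[OF _ \<open>i \<in> ?I\<close>] by auto
    \<comment> \<open>An odd start makes a window of length \<open>2 * n\<close> meet
      \<open>n + 1\<close> blocks, hence the length \<open>Suc n\<close> in
      \<open>open_count\<close>.\<close>
    also have "\<dots> \<longleftrightarrow> window i (Suc n) = window j (Suc n)"
      using window_double_eq_iff[of 1 "2 * n" i j] assms by simp
    finally show "cls (window (Suc (2 * i)) (2 * n)) = cls (window (Suc (2 * j)) (2 * n)) \<longleftrightarrow>
        window i (Suc n) = window j (Suc n)" .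
  qed
  finally show ?thesis by (simp add: open_count_def)
qed

section \<open>The linear lower bound and the limit inferior\<close>

text \<open>The bound on \<open>open_count\<close> has no error term, so the error does not
  accumulate under doubling. The constant 300 covers the loss 3 * 68 for odd \<open>n\<close> and
  the small lengths.\<close>

lemma cyclic_complexity_ge: "4 * n \<le> 3 * cyclic_complexity n + 300"
proof (induction n rule: less_induct)
  case (less n)
  show ?case
  proof (cases "n < 10")
    case False
    then have lower: "4 * m \<le> 3 * open_count m" if "m = n \<or> 2 * m = n" for m
      using end_counts_lower_bound[of m] that by auto
    show ?thesis
    proof (cases "even n")
      case True
      then obtain m where m: "n = 2 * m" by blast
      then show ?thesis
        using less[of m] lower[of m] cyclic_complexity_double[of m] False by simp
    next
      case odd: False
      then show ?thesis
        using cyclic_complexity_odd_ge[of n] lower[of n] False by simp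
    qed
  qed simp
qed

text \<open>The increments \<open>16 * 2 ^ k\<close> form a geometric sum. The value at 12 may stay
  unevaluated, since it vanishes after division by the length.\<close>

lemma cyclic_complexity_12_power:
  "cyclic_complexity (12 * 2 ^ k) + 16 = cyclic_complexity 12 + 16 * 2 ^ k"
proof (induction k)
  case (Suc k)
  have "(5::nat) \<le> 12 * 2 ^ k"
    using one_le_power[of "2::nat" k] by linarith
  from cyclic_complexity_double[OF this] Suc show ?case
    by (simp add: open_count_12_power algebra_simps)
qed simp

theorem corollary7:
  shows "liminf (\<lambda>n. ereal (real (cyclic_complexity n) / real n)) = ereal (4 / 3)"
proof (rule antisym)
  let ?f = "\<lambda>n. ereal (real (cyclic_complexity n) / real n)"
  let ?g = "\<lambda>n. 4 / 3 - 100 / real n"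
  have "?g \<longlonglongrightarrow> 4 / 3 - 0"
    by (intro tendsto_diff tendsto_const lim_const_over_n)
  then have "liminf (\<lambda>n. ereal (?g n)) = ereal (4 / 3)"
    by (intro lim_imp_Liminf) simp_all
  moreover have "?g n \<le> real (cyclic_complexity n) / real n" if "1 \<le> n" for n
  proof -
    have "4 / 3 * real n - 100 \<le> real (cyclic_complexity n)"
      using cyclic_complexity_ge[of n] by linarith
    then have "(4 / 3 * real n - 100) / real n \<le> real (cyclic_complexity n) / real n"
      by (rule divide_right_mono) simp
    then show ?thesis
      using that by (simp add: diff_divide_distrib)
  qed
  then have "liminf (\<lambda>n. ereal (?g n)) \<le> liminf ?f"
    by (intro Liminf_mono eventually_sequentiallyI[of 1]) simp
  ultimately show "ereal (4 / 3) \<le> liminf ?f" by simp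
  \<comment> \<open>The upper bound needs only one subsequence along which the quotient tends to
    16/12.\<close>
  define r :: "nat \<Rightarrow> nat" where "r k = 12 * 2 ^ k" for k
  have "strict_mono r"
    by (rule strict_monoI) (simp add: r_def)
  define c where "c = (real (cyclic_complexity 12) - 16) / 12"
  have "real (cyclic_complexity (r k)) / real (r k) = 4 / 3 + c * (1 / 2) ^ k" for k
  proof -
    have "real (cyclic_complexity (r k)) = real (cyclic_complexity 12) + 16 * 2 ^ k - 16"
      using arg_cong[OF cyclic_complexity_12_power[of k], of real] by (simp add: r_def)
    then show ?thesis
      by (simp add: r_def c_def field_simps)
  qed
  moreover have "(\<lambda>k. 4 / 3 + c * (1 / 2) ^ k) \<longlonglongrightarrow> 4 / 3 + c * 0"
    by (intro tendsto_intros LIMSEQ_power_zero) simp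
  ultimately have "(?f \<circ> r) \<longlonglongrightarrow> ereal (4 / 3)"
    by (simp add: o_def)
  then have "liminf (?f \<circ> r) = ereal (4 / 3)"
    by (intro lim_imp_Liminf) simp_all
  then show "liminf ?f \<le> ereal (4 / 3)"
    using liminf_subseq_mono[OF \<open>strict_mono r\<close>, of ?f] by simp
qed

end
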